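(* Every graph $G=(V,E)$ with at least two vertices contains two avoidable vertices whose distance to each other is the diameter of $G$.
   Context: Graphs are finite, simple, undirected, with non-empty vertex set. A vertex $v$ of a graph $G$ is avoidable if for every two distinct neighbors $x,y$ of $v$ there is an $x,y$-path in $G$ none of whose internal vertices is $v$ or a neighbor of $v$; equivalently, every induced $P_3$ (three-vertex path) having $v$ as its midpoint is contained in an induced cycle of $G$. The distance between two vertices is the length of a shortest path between them (infinite if they lie in different components). The eccentricity of a vertex $s$ is the largest distance from $s$ to a vertex of $G$, and the diameter of $G$ is the largest eccentricity among all vertices. *)

theory Defs
  imports "Graph_Theory.Graph_Theory" "HOL-Library.Extended_Nat"
begin

text \<open>
  The AFP locale \<open>graph\<close> models finite simple undirected graphs as finite symmetric digraphs
  without loops and without parallel arcs; \<open>v \<rightarrow>\<^bsub>G\<^esub> x\<close> is adjacency.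
  A path is a \<open>vpath\<close>, that is, a non-empty list of pairwise distinct vertices of which
  consecutive ones are adjacent. The locale allows the empty vertex set, on which
  \<open>eccentricity\<close> and \<open>graph_diameter\<close> are unspecified.
\<close>

definition path_between :: "('a, 'b) pre_digraph \<Rightarrow> 'a \<Rightarrow> 'a list \<Rightarrow> 'a \<Rightarrow> bool" where
  "path_between G x p y \<longleftrightarrow> vpath p G \<and> hd p = x \<and> last p = y"

definition internal_verts :: "'a list \<Rightarrow> 'a set" where
  "internal_verts p = set (butlast (tl p))"

definition avoidable :: "('a, 'b) pre_digraph \<Rightarrow> 'a \<Rightarrow> bool" where
  "avoidable G v \<longleftrightarrow> v \<in> verts G \<and>
     (\<forall>x y. v \<rightarrow>\<^bsub>G\<^esub> x \<and> v \<rightarrow>\<^bsub>G\<^esub> y \<and> x \<noteq> y \<longrightarrow>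
        (\<exists>p. path_between G x p y \<and>
             (\<forall>w\<in>internal_verts p. w \<noteq> v \<and> \<not> v \<rightarrow>\<^bsub>G\<^esub> w)))"

text \<open>
  The infimum in \<open>enat\<close> is the minimum if there is a path from \<open>u\<close> to \<open>v\<close>, and \<open>\<infinity>\<close> otherwise.
\<close>

definition graph_dist :: "('a, 'b) pre_digraph \<Rightarrow> 'a \<Rightarrow> 'a \<Rightarrow> enat" where
  "graph_dist G u v = (INF p\<in>{p. path_between G u p v}. enat (vwalk_length p))"

definition eccentricity :: "('a, 'b) pre_digraph \<Rightarrow> 'a \<Rightarrow> enat" where
  "eccentricity G s = Max (graph_dist G s ` verts G)"

definition graph_diameter :: "('a, 'b) pre_digraph \<Rightarrow> enat" where
  "graph_diameter G = Max (eccentricity G ` verts G)"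

end

theory Submission
  imports Defs
begin

text \<open>
  It suffices to find, for every vertex \<open>s\<close>, an avoidable vertex whose distance from \<open>s\<close> is the
  eccentricity of \<open>s\<close>: applied to an end of a diametral pair this gives an avoidable \<open>u\<close> of maximal
  eccentricity, and applied to \<open>u\<close> it gives \<open>v\<close>. The vertices at distance at least two less than the
  eccentricity form a connected set \<open>D\<close>, and the farthest vertices are those outside the closed
  neighbourhood of \<open>D\<close>. Enlarge \<open>D\<close> to a maximal connected set \<open>C\<close> whose closed neighbourhood
  misses some vertex. By maximality every vertex of the boundary of \<open>C\<close> is adjacent to all of the
  set \<open>R\<close> of missed vertices. A vertex that is avoidable in the subgraph induced by \<open>R\<close>,
  which exists by induction, is then avoidable in the whole graph: two neighbours outside \<open>R\<close> are
  joined through \<open>C\<close>, and a neighbour outside \<open>R\<close> is adjacent to every neighbour inside \<open>R\<close>.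
  If the eccentricity is 1, then \<open>D\<close> is empty and the argument is applied to the graph without \<open>s\<close>,
  since a vertex avoidable there remains so after adding the universal vertex \<open>s\<close>.
\<close>

section \<open>Avoidability relative to a set of vertices\<close>

definition connected_in :: "'a rel \<Rightarrow> 'a set \<Rightarrow> bool" where
  "connected_in E C \<longleftrightarrow> C \<times> C \<subseteq> (E \<inter> C \<times> C)\<^sup>*"

text \<open>Fixing \<open>E\<close> and varying \<open>W\<close> treats induced subgraphs without
  changing the graph. \<open>A\<close> stands for the vertices of a joining path. The neighbourhood
  of \<open>v\<close> is not cut down to \<open>W\<close>, so that the same \<open>A\<close> serves
  in every larger set.\<close>

definition avoidable_in :: "'a rel \<Rightarrow> 'a set \<Rightarrow> 'a \<Rightarrow> bool" where
  "avoidable_in E W v \<longleftrightarrow> v \<in> W \<and>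
     (\<forall>x\<in>W. \<forall>y\<in>W. (v, x) \<in> E \<and> (v, y) \<in> E \<and> x \<noteq> y \<longrightarrow>
        (\<exists>A \<subseteq> W. A \<inter> insert v (E `` {v}) \<subseteq> {x, y} \<and> (x, y) \<in> (E \<inter> A \<times> A)\<^sup>*))"

lemma avoidable_inE:
  assumes "avoidable_in E W v" "x \<in> W" "y \<in> W" "(v, x) \<in> E" "(v, y) \<in> E" "x \<noteq> y"
  obtains A where "A \<subseteq> W" "A \<inter> insert v (E `` {v}) \<subseteq> {x, y}" "(x, y) \<in> (E \<inter> A \<times> A)\<^sup>*"
proof -
  have "\<exists>A \<subseteq> W. A \<inter> insert v (E `` {v}) \<subseteq> {x, y} \<and> (x, y) \<in> (E \<inter> A \<times> A)\<^sup>*"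
    using assms by (simp add: avoidable_in_def)
  then show ?thesis
    using that by auto
qed

lemma avoidable_in_adjacent:
  assumes "(x, y) \<in> E" "x \<in> W" "y \<in> W"
  shows "\<exists>A \<subseteq> W. A \<inter> insert v (E `` {v}) \<subseteq> {x, y} \<and> (x, y) \<in> (E \<inter> A \<times> A)\<^sup>*"
  using assms by (intro exI[of _ "{x, y}"]) auto

lemma rtrancl_restrict_mono:
  assumes "(x, y) \<in> (E \<inter> A \<times> A)\<^sup>*" "A \<subseteq> B"
  shows "(x, y) \<in> (E \<inter> B \<times> B)\<^sup>*"
  using assms rtrancl_mono[of "E \<inter> A \<times> A" "E \<inter> B \<times> B"] by blast

lemma connected_in_insert:
  assumes "sym E" "connected_in E C" "c \<in> C" "(c, x) \<in> E"
  shows "connected_in E (insert x C)"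
proof -
  let ?R = "E \<inter> insert x C \<times> insert x C"
  have C: "(a, b) \<in> ?R\<^sup>*" if "a \<in> C" "b \<in> C" for a b
    using assms(2) that rtrancl_restrict_mono[of a b E C "insert x C"]
    unfolding connected_in_def by blast
  have cx: "(c, x) \<in> ?R" "(x, c) \<in> ?R"
    using assms by (auto dest: symD)
  have "(a, c) \<in> ?R\<^sup>*" "(c, a) \<in> ?R\<^sup>*" if "a \<in> insert x C" for a
    using that C[of a c] C[of c a] cx assms(3) by auto
  then show ?thesis
    unfolding connected_in_def by (blast intro: rtrancl_trans)
qed

lemma avoidable_in_outside_nbhd:
  fixes E :: "'a rel"
  assumes E: "sym E" "irrefl E"
    and "finite W" "D \<subseteq> W" "connected_in E D" "\<not> W \<subseteq> D \<union> E `` D"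
  shows "\<exists>v \<in> W - (D \<union> E `` D). avoidable_in E W v"
  using assms(3-)
\<comment> \<open>\<open>D\<close> must vary: the inductive call is made with the empty set, which
  counts as connected.\<close>
proof (induction W arbitrary: D rule: finite_psubset_induct)
  case (psubset W D)
  define P where "P C \<longleftrightarrow> D \<subseteq> C \<and> C \<subseteq> W \<and> connected_in E C \<and> \<not> W \<subseteq> C \<union> E `` C" for C
  have "finite {C. P C}"
    by (rule finite_subset[of _ "Pow W"]) (use psubset.hyps in \<open>auto simp: P_def\<close>)
  moreover have "D \<in> {C. P C}"
    using psubset.prems by (auto simp: P_def)
  ultimately have "\<exists>C \<in> {C. P C}. D \<subseteq> C \<and> (\<forall>C' \<in> {C. P C}. C \<subseteq> C' \<longrightarrow> C = C')"
    by (rule finite_has_maximal2)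
  then obtain C where "P C" and maxC: "\<And>C'. P C' \<Longrightarrow> C \<subseteq> C' \<Longrightarrow> C = C'"
    by auto
  then have C: "D \<subseteq> C" "C \<subseteq> W" "connected_in E C" "\<not> W \<subseteq> C \<union> E `` C"
    by (auto simp: P_def)
  define R where "R = W - (C \<union> E `` C)"
  have "R \<noteq> {}" and RD: "R \<subseteq> W - (D \<union> E `` D)" and RW: "R \<subseteq> W"
    using C by (auto simp: R_def)
  \<comment> \<open>Without this edge, \<open>insert x C\<close> would be connected and still miss
    \<open>w\<close>, against maximality.\<close>
  have complete: "(x, w) \<in> E" if x: "x \<in> W" "x \<in> E `` C" "x \<notin> C" and w: "w \<in> R" for x w
  proof (rule ccontr)
    assume "(x, w) \<notin> E"
    then have "w \<in> W - (insert x C \<union> E `` insert x C)"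
      using x w by (auto simp: R_def)
    moreover have "connected_in E (insert x C)"
      using x C E connected_in_insert by fast
    ultimately have "P (insert x C)"
      using x C by (auto simp: P_def)
    then show False
      using maxC[of "insert x C"] x by blast
  qed
  have "\<exists>v\<in>R. avoidable_in E W v"
  proof (cases "C = {}")
    case True
    have "(x, y) \<in> E" if "x \<in> W" "y \<in> W" "x \<noteq> y" for x y
    proof (rule ccontr)
      assume "(x, y) \<notin> E"
      then have "P {x}"
        using that True C(1) by (auto simp: P_def connected_in_def)
      then show False
        using maxC[of "{x}"] True by blast
    qed
    then have "avoidable_in E W v" if "v \<in> W" for v
      using that by (simp add: avoidable_in_def avoidable_in_adjacent)
    then show ?thesis
      using \<open>R \<noteq> {}\<close> RW by blast
  next
    case False
    then have "R \<subset> W"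
      using C by (auto simp: R_def)
    then obtain v where v: "v \<in> R" "avoidable_in E R v"
      using psubset.IH[of R "{}"] \<open>R \<noteq> {}\<close> by (auto simp: connected_in_def)
    have "\<exists>A \<subseteq> W. A \<inter> insert v (E `` {v}) \<subseteq> {x, y} \<and> (x, y) \<in> (E \<inter> A \<times> A)\<^sup>*"
      if xy: "x \<in> W" "y \<in> W" "(v, x) \<in> E" "(v, y) \<in> E" "x \<noteq> y" for x y
    proof -
      \<comment> \<open>A neighbour of \<open>v\<close> in \<open>C\<close> would put
        \<open>v\<close> into the neighbourhood of \<open>C\<close>, which \<open>R\<close>
        avoids.\<close>
      have notC: "x \<notin> C" "y \<notin> C"
        using v(1) xy E(1) by (auto simp: R_def dest: symD)
      consider "x \<in> R" "y \<in> R" | "x \<in> R" "y \<in> E `` C" | "x \<in> E `` C" "y \<in> R"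
        | "x \<in> E `` C" "y \<in> E `` C"
        using xy notC by (auto simp: R_def)
      then show ?thesis
      proof cases
        case 1
        then obtain A where "A \<subseteq> R" "A \<inter> insert v (E `` {v}) \<subseteq> {x, y}" "(x, y) \<in> (E \<inter> A \<times> A)\<^sup>*"
          by (rule avoidable_inE[OF v(2) _ _ xy(3-5)])
        then show ?thesis
          using RW by (intro exI[of _ A]) simp
      next
        case 2
        then have "(x, y) \<in> E"
          using complete[of y x] xy notC E(1) by (auto dest: symD)
        then show ?thesis
          using xy avoidable_in_adjacent by metis
      next
        case 3
        then have "(x, y) \<in> E"
          using complete xy notC by blast
        then show ?thesis
          using xy avoidable_in_adjacent by metis
      next
        case 4
        let ?A = "insert x (insert y C)"
        obtain c d where cd: "c \<in> C" "(c, x) \<in> E" "d \<in> C" "(d, y) \<in> E"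
          using 4 by auto
        have "(x, c) \<in> E \<inter> ?A \<times> ?A" "(d, y) \<in> E \<inter> ?A \<times> ?A"
          using cd E(1) by (auto dest: symD)
        moreover have "(c, d) \<in> (E \<inter> ?A \<times> ?A)\<^sup>*"
          by (rule rtrancl_restrict_mono[of _ _ _ C])
            (use cd C(3) in \<open>auto simp: connected_in_def\<close>)
        ultimately have "(x, y) \<in> (E \<inter> ?A \<times> ?A)\<^sup>*"
          by (meson converse_rtrancl_into_rtrancl rtrancl_into_rtrancl)
        moreover have "C \<inter> insert v (E `` {v}) = {}"
          using v(1) E(1) by (auto simp: R_def dest: symD)
        ultimately show ?thesis
          using xy C(2) by (intro exI[of _ ?A]) auto
      qed
    qed
    then have "avoidable_in E W v"
      using v(1) RW by (auto simp: avoidable_in_def)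
    then show ?thesis
      using v(1) by blast
  qed
  then show ?case
    using RD by blast
qed

section \<open>Walks, paths and the transfer to \<open>avoidable\<close>\<close>

lemma path_between_if_walk:
  assumes "vwalk p G"
  shows "\<exists>q. path_between G (hd p) q (last p) \<and> set q \<subseteq> set p \<and> vwalk_length q \<le> vwalk_length p"
proof -
  have len: "length (vwalk_to_vpath xs) \<le> length xs" for xs :: "'a list"
    by (induct xs rule: vwalk_to_vpath_induct3)
      (auto intro: order_trans[OF _ length_dropWhile_le] le_SucI)
  show ?thesis
    using assms vwalk_to_vpath_vpath[OF assms] vwalk_to_vpath_hd[of p] vwalk_to_vpath_last[of p]
      vwalk_to_vpath_subset[of _ p] len[of p]
    by (intro exI[of _ "vwalk_to_vpath p"]) (auto simp: path_between_def)
qed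

lemma (in wf_digraph) walk_snoc:
  assumes "vwalk p G" "last p \<rightarrow>\<^bsub>G\<^esub> w"
  shows "vwalk (p @ [w]) G"
  using assms adj_in_verts[OF assms(2)]
  by (auto simp: vwalk_def set_vwalk_arcs_snoc)

lemma (in wf_digraph) walk_in_set_if_rtrancl:
  assumes "(x, y) \<in> (arcs_ends G \<inter> A \<times> A)\<^sup>*" "x \<in> verts G" "x \<in> A"
  shows "\<exists>p. vwalk p G \<and> hd p = x \<and> last p = y \<and> set p \<subseteq> A"
  using assms
proof (induction rule: rtrancl_induct)
  case base
  then show ?case by (intro exI[of _ "[x]"]) auto
next
  case (step y z)
  then obtain p where p: "vwalk p G" "hd p = x" "last p = y" "set p \<subseteq> A"
    by blast
  then have "vwalk (p @ [z]) G" "p \<noteq> []"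
    using walk_snoc step by auto
  then show ?case
    using p step by (intro exI[of _ "p @ [z]"]) auto
qed

lemma internal_verts_path_between:
  assumes "path_between G x p y" "w \<in> internal_verts p"
  shows "w \<in> set p" "w \<noteq> x" "w \<noteq> y"
proof -
  have d: "distinct p" "p \<noteq> []" "hd p = x" "last p = y"
    using assms(1) by (auto simp: path_between_def vpath_def vwalk_def)
  have w: "w \<in> set (butlast (tl p))"
    using assms(2) by (simp add: internal_verts_def)
  then obtain q where p: "p = x # q" "q \<noteq> []"
    using d by (cases p; cases "tl p") auto
  then have q: "q = butlast q @ [y]"
    using d by (metis append_butlast_last_id last_ConsR)
  have "distinct (x # butlast q @ [y])"
    using d(1) p q by metis
  then show "w \<in> set p" "w \<noteq> x" "w \<noteq> y"
    using w p by (auto dest: in_set_butlastD)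
qed

lemma (in wf_digraph) avoidable_if_avoidable_in:
  assumes "avoidable_in (arcs_ends G) (verts G) v"
  shows "avoidable G v"
  unfolding avoidable_def
proof (intro conjI allI impI)
  show "v \<in> verts G"
    using assms by (simp add: avoidable_in_def)
next
  fix x y assume "v \<rightarrow>\<^bsub>G\<^esub> x \<and> v \<rightarrow>\<^bsub>G\<^esub> y \<and> x \<noteq> y"
  then have xy: "x \<in> verts G" "y \<in> verts G" "v \<rightarrow>\<^bsub>G\<^esub> x" "v \<rightarrow>\<^bsub>G\<^esub> y" "x \<noteq> y"
    by (auto dest: adj_in_verts)
  obtain A where A: "A \<subseteq> verts G" "A \<inter> insert v (arcs_ends G `` {v}) \<subseteq> {x, y}"
    "(x, y) \<in> (arcs_ends G \<inter> A \<times> A)\<^sup>*"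
    by (rule avoidable_inE[OF assms xy])
  \<comment> \<open>Since \<open>x\<close> and \<open>y\<close> differ, the chain has a first step,
    and this step lies in \<open>A \<times> A\<close>.\<close>
  then have "x \<in> A"
    using xy(5) by (metis IntD2 SigmaD1 converse_rtranclE)
  then obtain p where p: "vwalk p G" "hd p = x" "last p = y" "set p \<subseteq> A"
    using walk_in_set_if_rtrancl[OF A(3) xy(1)] by metis
  then obtain q where q: "path_between G x q y" "set q \<subseteq> A"
    using path_between_if_walk[of p G] by blast
  \<comment> \<open>\<open>A\<close> meets the closed neighbourhood of \<open>v\<close> at most in
    \<open>x\<close> and \<open>y\<close>, and a path has neither of its ends in its
    interior.\<close>
  have "w \<noteq> v \<and> \<not> v \<rightarrow>\<^bsub>G\<^esub> w" if "w \<in> internal_verts q" for w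
    using internal_verts_path_between[OF q(1) that] q(2) A(2) by blast
  then show "\<exists>p. path_between G x p y \<and> (\<forall>w\<in>internal_verts p. w \<noteq> v \<and> \<not> v \<rightarrow>\<^bsub>G\<^esub> w)"
    using q(1) by blast
qed

section \<open>Distances\<close>

lemma graph_dist_le_walk:
  assumes "vwalk p G"
  shows "graph_dist G (hd p) (last p) \<le> enat (vwalk_length p)"
proof -
  obtain q where "path_between G (hd p) q (last p)" "vwalk_length q \<le> vwalk_length p"
    using path_between_if_walk[OF assms] by blast
  then show ?thesis
    unfolding graph_dist_def by (intro INF_lower2[of q]) auto
qed

lemma graph_dist_enatE:
  assumes "graph_dist G s v = enat n"
  obtains p where "vwalk p G" "hd p = s" "last p = v" "vwalk_length p = n"
proof -
  let ?S = "(\<lambda>p. enat (vwalk_length p)) ` {p. path_between G s p v}"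
  \<comment> \<open>The infimum of the empty set is \<infinity>; a nonempty set in
    \<open>enat\<close> attains its infimum by well-ordering.\<close>
  have "?S \<noteq> {}"
    using assms unfolding graph_dist_def by (metis Inf_empty enat.distinct(2) top_enat_def)
  then have "Inf ?S \<in> ?S"
    by (metis (mono_tags, lifting) Inf_enat_def LeastI_ex ex_in_conv)
  then obtain p where "path_between G s p v" "enat n = enat (vwalk_length p)"
    using assms unfolding graph_dist_def by auto
  then show ?thesis
    using that by (auto simp: path_between_def vpath_def)
qed

lemma graph_dist_commute:
  assumes "symmetric G"
  shows "graph_dist G u v = graph_dist G v u"
proof -
  have "graph_dist G v u \<le> graph_dist G u v" for u v
  proof (cases "graph_dist G u v")
    case (enat n)
    then obtain p where p: "vwalk p G" "hd p = u" "last p = v" "vwalk_length p = n"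
      by (rule graph_dist_enatE)
    then show ?thesis
      using graph_dist_le_walk[OF vwalk_rev_ex[OF assms p(1)]] enat by (simp add: hd_rev last_rev)
  qed simp
  then show ?thesis
    by (simp add: antisym)
qed

lemma graph_dist_self:
  assumes "s \<in> verts G"
  shows "graph_dist G s s = 0"
  using graph_dist_le_walk[of "[s]" G] assms by (auto simp: zero_enat_def[symmetric])

lemma graph_dist_0D:
  assumes "graph_dist G s v = 0"
  shows "v = s"
proof -
  obtain p where "vwalk p G" "hd p = s" "last p = v" "vwalk_length p = 0"
    using graph_dist_enatE assms unfolding zero_enat_def by metis
  then show ?thesis
    by (cases p) (auto simp: vwalk_def)
qed

lemma (in wf_digraph) graph_dist_adj:
  assumes "v \<rightarrow>\<^bsub>G\<^esub> w"
  shows "graph_dist G s w \<le> eSuc (graph_dist G s v)"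
proof (cases "graph_dist G s v")
  case (enat n)
  then obtain p where p: "vwalk p G" "hd p = s" "last p = v" "vwalk_length p = n"
    by (rule graph_dist_enatE)
  then have "p \<noteq> []" "vwalk (p @ [w]) G"
    using walk_snoc assms by auto
  then show ?thesis
    using graph_dist_le_walk[of "p @ [w]" G] p enat by (auto simp: eSuc_enat)
qed simp

text \<open>The last vertex but one of a shortest walk works: the shortened walk bounds its distance
  by \<open>n\<close> from above, the last arc from below.\<close>

lemma (in wf_digraph) graph_dist_predecessor:
  assumes "graph_dist G s w = enat (Suc n)"
  obtains v where "v \<rightarrow>\<^bsub>G\<^esub> w" "graph_dist G s v = enat n"
proof -
  obtain p where p: "vwalk p G" "hd p = s" "last p = w" "vwalk_length p = Suc n"
    using assms by (rule graph_dist_enatE)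
  then have len: "length p = Suc (Suc n)"
    by simp
  define q where "q = butlast p"
  have q: "q \<noteq> []" "p = q @ [w]" "length q = Suc n"
    using len p(3) append_butlast_last_id[of p] by (cases p; auto simp: q_def; fail)+
  have "vwalk q G" "hd q = s"
    using p q vwalkI_append_l by auto
  then have "graph_dist G s (last q) \<le> enat n"
    using graph_dist_le_walk[of q G] q by simp
  moreover have adj: "last q \<rightarrow>\<^bsub>G\<^esub> w"
    using p(1) q by (auto simp: vwalk_def set_vwalk_arcs_snoc)
  moreover have "enat (Suc n) \<le> eSuc (graph_dist G s (last q))"
    using graph_dist_adj[OF adj] assms by metis
  ultimately have "graph_dist G s (last q) = enat n"
    by (cases "graph_dist G s (last q)") (auto simp: eSuc_enat)
  then show ?thesis
    using that adj by blast
qed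

section \<open>Eccentricity and avoidable farthest vertices\<close>

lemma (in fin_digraph) graph_dist_le_eccentricity:
  assumes "v \<in> verts G"
  shows "graph_dist G s v \<le> eccentricity G s"
  using assms unfolding eccentricity_def by (intro Max_ge) auto

lemma (in fin_digraph) eccentricity_attained:
  assumes "verts G \<noteq> {}"
  obtains v where "v \<in> verts G" "graph_dist G s v = eccentricity G s"
proof -
  have "eccentricity G s \<in> graph_dist G s ` verts G"
    using assms unfolding eccentricity_def by (intro Max_in) auto
  then show ?thesis
    using that by (metis imageE)
qed

text \<open>A shortest walk from \<open>s\<close> to a member passes only through vertices nearer to
  \<open>s\<close>, so it stays in the set and links every member to \<open>s\<close>.\<close>

lemma (in wf_digraph) connected_in_dist_less:
  assumes "sym (arcs_ends G)"
  shows "connected_in (arcs_ends G) {v \<in> verts G. eSuc (graph_dist G s v) < k}"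
    (is "connected_in _ ?D")
proof -
  let ?R = "arcs_ends G \<inter> ?D \<times> ?D"
  have from_s: "(s, v) \<in> ?R\<^sup>*" if "v \<in> ?D" "graph_dist G s v = enat n" for v n
    using that
  proof (induction n arbitrary: v)
    case 0
    then show ?case
      using graph_dist_0D[of G s v] by (simp add: zero_enat_def)
  next
    case (Suc n)
    obtain u where u: "u \<rightarrow>\<^bsub>G\<^esub> v" "graph_dist G s u = enat n"
      using Suc.prems(2) by (rule graph_dist_predecessor)
    have "enat (Suc n) < enat (Suc (Suc n))"
      by simp
    also have "\<dots> < k"
      using Suc.prems by (simp add: eSuc_enat)
    finally have "u \<in> ?D"
      using u adj_in_verts by (auto simp: eSuc_enat)
    then have "(s, u) \<in> ?R\<^sup>*" "(u, v) \<in> ?R"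
      using Suc.IH u Suc.prems(1) by blast+
    then show ?case
      by (rule rtrancl_into_rtrancl)
  qed
  have from_s': "(s, v) \<in> ?R\<^sup>*" if "v \<in> ?D" for v
    using that from_s[OF that] by (cases "graph_dist G s v") auto
  have "sym ?R"
    using assms by (auto simp: sym_def)
  then have "(a, s) \<in> ?R\<^sup>*" if "a \<in> ?D" for a
    using symD[OF sym_rtrancl from_s'[OF that]] by simp
  then have "(a, b) \<in> ?R\<^sup>*" if "a \<in> ?D" "b \<in> ?D" for a b
    using rtrancl_trans[of a s ?R b] from_s' that by simp
  then show ?thesis
    unfolding connected_in_def by blast
qed

lemma (in graph) avoidable_at_eccentricity:
  assumes s: "s \<in> verts G" and card: "card (verts G) \<ge> 2"
  obtains v where "avoidable G v" "graph_dist G s v = eccentricity G s"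
proof -
  let ?E = "arcs_ends G" and ?e = "eccentricity G s"
  have E: "sym ?E" "irrefl ?E"
    using sym_arcs no_loops by (auto simp: symmetric_def irrefl_def arcs_ends_conv)
  have ne: "verts G - {s} \<noteq> {}"
  proof
    assume "verts G - {s} = {}"
    then have "verts G = {s}" using s by blast
    then show False using card by simp
  qed
  then obtain t where t: "t \<in> verts G" "t \<noteq> s"
    by blast
  have pos: "?e \<noteq> 0"
    using graph_dist_le_eccentricity[OF t(1), of s] graph_dist_0D[of G s t] t(2) by auto
  show ?thesis
  proof (cases "?e = 1")
    case True
    \<comment> \<open>A nonzero distance of at most 1 is 1, and the predecessor at distance 0 is
      \<open>s\<close> itself; so \<open>s\<close> is universal.\<close>
    have dist1: "graph_dist G s w = 1" "s \<rightarrow>\<^bsub>G\<^esub> w" if w: "w \<in> verts G" "w \<noteq> s" for w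
    proof -
      have "graph_dist G s w \<noteq> 0"
        using w graph_dist_0D by metis
      then show d: "graph_dist G s w = 1"
        using graph_dist_le_eccentricity[OF w(1), of s] True
        by (metis antisym ileI1 one_eSuc zero_less_iff_neq_zero)
      then obtain u where "u \<rightarrow>\<^bsub>G\<^esub> w" "graph_dist G s u = 0"
        using graph_dist_predecessor[of s w 0] by (auto simp: one_enat_def zero_enat_def)
      then show "s \<rightarrow>\<^bsub>G\<^esub> w"
        using graph_dist_0D by metis
    qed
    obtain v where v: "v \<in> verts G - {s}" "avoidable_in ?E (verts G - {s}) v"
      using avoidable_in_outside_nbhd[OF E, of "verts G - {s}" "{}"] ne
      by (auto simp: connected_in_def)
    have "avoidable_in ?E (verts G) v"
      unfolding avoidable_in_def
    proof (intro conjI ballI impI)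
      fix x y assume xy: "x \<in> verts G" "y \<in> verts G" "v \<rightarrow>\<^bsub>G\<^esub> x \<and> v \<rightarrow>\<^bsub>G\<^esub> y \<and> x \<noteq> y"
      then have nbrs: "v \<rightarrow>\<^bsub>G\<^esub> x" "v \<rightarrow>\<^bsub>G\<^esub> y" "x \<noteq> y"
        by auto
      show "\<exists>A \<subseteq> verts G. A \<inter> insert v (?E `` {v}) \<subseteq> {x, y} \<and> (x, y) \<in> (?E \<inter> A \<times> A)\<^sup>*"
      \<comment> \<open>A pair containing \<open>s\<close> is joined by an edge; any other pair
        keeps the witness set found without \<open>s\<close>.\<close>
      proof (cases "x = s \<or> y = s")
        case True
        then have "(x, y) \<in> ?E"
          using dist1(2)[of x] dist1(2)[of y] xy E(1) by (auto dest: symD)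
        then show ?thesis
          using avoidable_in_adjacent xy by metis
      next
        case False
        then have "x \<in> verts G - {s}" "y \<in> verts G - {s}"
          using xy by auto
        then obtain A where "A \<subseteq> verts G - {s}" "A \<inter> insert v (?E `` {v}) \<subseteq> {x, y}"
          "(x, y) \<in> (?E \<inter> A \<times> A)\<^sup>*"
          by (rule avoidable_inE[OF v(2) _ _ nbrs])
        then show ?thesis
          by (intro exI[of _ A] conjI) auto
      qed
    qed (use v in auto)
    then show ?thesis
      using that avoidable_if_avoidable_in dist1(1)[of v] v(1) True by auto
  next
    case False
    \<comment> \<open>For finite \<open>?e\<close> this is the ball of radius \<open>?e - 2\<close>
      about \<open>s\<close>. In a disconnected graph \<open>?e\<close> is \<infinity> and
      \<open>D\<close> is the component of \<open>s\<close>. Using \<open>eSuc\<close> avoids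
      subtraction and covers both cases.\<close>
    define D where "D = {v \<in> verts G. eSuc (graph_dist G s v) < ?e}"
    have "eSuc 0 < ?e"
      using pos False by (cases ?e) (auto simp: zero_enat_def one_enat_def eSuc_enat)
    then have sD: "s \<in> D"
      using s graph_dist_self[OF s] by (simp add: D_def)
    obtain t where t: "t \<in> verts G" "graph_dist G s t = ?e"
      using eccentricity_attained[of s] s by blast
    \<comment> \<open>A neighbour of a member of \<open>D\<close> is strictly nearer to
      \<open>s\<close> than \<open>?e\<close>, whereas \<open>t\<close> is at distance
      \<open>?e\<close>.\<close>
    have "t \<notin> ?E `` D"
    proof
      assume "t \<in> ?E `` D"
      then obtain u where u: "u \<in> D" "u \<rightarrow>\<^bsub>G\<^esub> t"
        by blast
      then show False
        using graph_dist_adj[OF u(2), of s] t(2) by (auto simp: D_def)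
    qed
    moreover have "t \<notin> D"
      using t(2) ile_eSuc[of ?e] by (auto simp: D_def simp flip: not_le)
    ultimately have "\<not> verts G \<subseteq> D \<union> ?E `` D"
      using t(1) by blast
    moreover have "connected_in ?E D"
      unfolding D_def by (rule connected_in_dist_less[OF E(1)])
    ultimately obtain v where v: "v \<in> verts G - (D \<union> ?E `` D)" "avoidable_in ?E (verts G) v"
      using avoidable_in_outside_nbhd[OF E, of "verts G" D] by (auto simp: D_def)
    \<comment> \<open>A nearer \<open>v\<close> would either be \<open>s\<close>, a member of
      \<open>D\<close>, or have a predecessor in \<open>D\<close> and so be a neighbour of
      \<open>D\<close>.\<close>
    have "graph_dist G s v = ?e"
    proof (rule ccontr)
      assume "graph_dist G s v \<noteq> ?e"
      then have less: "graph_dist G s v < ?e"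
        using graph_dist_le_eccentricity[of v s] v(1) by auto
      then obtain n where n: "graph_dist G s v = enat n"
        by (cases "graph_dist G s v") auto
      show False
      proof (cases n)
        case 0
        then show False
          using n graph_dist_0D[of G s v] sD v(1) by (auto simp: zero_enat_def)
      next
        case (Suc m)
        then obtain u where "u \<rightarrow>\<^bsub>G\<^esub> v" "graph_dist G s u = enat m"
          using n graph_dist_predecessor by metis
        then show False
          using v(1) less n Suc adj_in_verts by (auto simp: D_def eSuc_enat)
      qed
    qed
    then show ?thesis
      using that avoidable_if_avoidable_in v(2) by blast
  qed
qed

theorem theorem4p4:
  fixes G :: "('a, 'b) pre_digraph"
  assumes "graph G"
    and "card (verts G) \<ge> 2"
  shows "\<exists>u v. u \<noteq> v \<and> avoidable G u \<and> avoidable G v \<and> graph_dist G u v = graph_diameter G"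
proof -
  interpret graph G by fact
  have ne: "verts G \<noteq> {}"
    using assms(2) by auto
  have "graph_diameter G \<in> eccentricity G ` verts G"
    unfolding graph_diameter_def using ne by (intro Max_in) auto
  then obtain s where s: "s \<in> verts G" "eccentricity G s = graph_diameter G"
    by (metis imageE)
  have le: "eccentricity G u \<le> graph_diameter G" if "u \<in> verts G" for u
    unfolding graph_diameter_def using that by (intro Max_ge) auto
  obtain u where u: "avoidable G u" "graph_dist G s u = graph_diameter G"
    using avoidable_at_eccentricity[OF s(1) assms(2)] s(2) by metis
  then have uV: "u \<in> verts G"
    by (simp add: avoidable_def)
  \<comment> \<open>The distance from \<open>u\<close> back to \<open>s\<close> already equals the
    diameter.\<close>
  have "eccentricity G u = graph_diameter G"
    using le[OF uV] graph_dist_le_eccentricity[OF s(1), of u] u(2)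
      graph_dist_commute[OF sym_arcs, of s u] by auto
  then obtain v where v: "avoidable G v" "graph_dist G u v = graph_diameter G"
    using avoidable_at_eccentricity[OF uV assms(2)] by metis
  \<comment> \<open>Equality would make the diameter 0 and leave only one vertex.\<close>
  have "u \<noteq> v"
  proof
    assume "u = v"
    then have diam: "graph_diameter G = 0"
      using v(2) graph_dist_self[OF uV] by simp
    have "w = u" if "w \<in> verts G" for w
      using graph_dist_le_eccentricity[OF that, of u] le[OF uV] diam graph_dist_0D by fastforce
    then have "verts G = {u}"
      using uV by blast
    then show False
      using assms(2) by simp
  qed
  then show ?thesis
    using u v by blast
qed

end
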